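(* Let $p=\sum_{J\subseteq [n]}p_Jx^J\in\mathbb{R}[x_1,\dots,x_n]$ be a square-free polynomial with $p(0)=0$. Let $p_{\max}=\max_{x\in[0,1]^n}p(x)$. For any integer $t\ge 1$ satisfying $\deg(p)\le t\le n$, we have $$p_{\mathrm{han}}^{(t)}\le \frac{n}{t}\,p_{\max}+\sum_{J\subseteq [n]:\ |J|\ge 2,\ p_J>0}p_J\lambda_J,\qquad\text{where}\quad \lambda_J=\frac{\binom{n-1}{t-1}-\binom{n-|J|}{t-|J|}}{\binom{n-1}{t-1}}.$$ Hence, if $p_J\le 0$ for all $J\subseteq[n]$ with $|J|\ge 2$, then $p_{\mathrm{han}}^{(t)}\le \frac{n}{t}\,p_{\max}$.
   Context: Notation: $[n]=\{1,\dots,n\}$; for $J\subseteq[n]$, $x^J=\prod_{i\in J}x_i$. A polynomial is square-free if it is a real linear combination of the monomials $x^J$, $J\subseteq[n]$. (Since $\deg(p)\le t$, only sets $J$ with $|J|\le t$ have $p_J\neq 0$.) For an integer $t\ge1$, the Handelman set of order $t$ of the hypercube is $$\mathcal{H}_t=\Big\{\sum_{\alpha,\beta\in\mathbb{N}^n:\ |\alpha+\beta|\le t}c_{\alpha,\beta}\prod_{i=1}^n x_i^{\alpha_i}(1-x_i)^{\beta_i}:\ c_{\alpha,\beta}\ge 0\Big\},$$ where $|\alpha|=\sum_i\alpha_i$. The Handelman bound of order $t$ for maximizing $p$ over $[0,1]^n$ is $p_{\mathrm{han}}^{(t)}=\inf\{\lambda\in\mathbb{R}:\lambda-p\in\mathcal{H}_t\}$.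 *)

theory Defs
  imports "HOL-Analysis.Analysis" "HOL-Library.Poly_Mapping"
begin

text \<open>
  Real multivariate polynomials are elements of the monoid algebra over finitely supported
  exponent vectors. Only the variables with index in \<open>{1..n}\<close> are used; exponent vectors in
  \<open>\<nat>\<^sup>n\<close> and points of \<open>[0,1]\<^sup>n\<close> are extensional functions on \<open>{1..n}\<close>.
\<close>

type_synonym rpoly = "(nat \<Rightarrow>\<^sub>0 nat) \<Rightarrow>\<^sub>0 real"

definition Const :: "real \<Rightarrow> rpoly"
  where "Const c = Poly_Mapping.single 0 c"

definition Var :: "nat \<Rightarrow> rpoly"
  where "Var i = Poly_Mapping.single (Poly_Mapping.single i 1) 1"

definition poly_eval :: "rpoly \<Rightarrow> (nat \<Rightarrow> real) \<Rightarrow> real"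
  where "poly_eval p x =
    (\<Sum>m\<in>Poly_Mapping.keys p.
       Poly_Mapping.lookup p m * (\<Prod>i\<in>Poly_Mapping.keys m. x i ^ Poly_Mapping.lookup m i))"

text \<open>The zero polynomial gets total degree 0.\<close>

definition total_degree :: "rpoly \<Rightarrow> nat"
  where "total_degree p =
    Max (insert 0 ((\<lambda>m. \<Sum>i\<in>Poly_Mapping.keys m. Poly_Mapping.lookup m i) ` Poly_Mapping.keys p))"

definition cube :: "nat \<Rightarrow> (nat \<Rightarrow> real) set"
  where "cube n = {1..n} \<rightarrow>\<^sub>E {0..1}"

definition cube_max :: "nat \<Rightarrow> rpoly \<Rightarrow> real"
  where "cube_max n p = (GREATEST v. v \<in> poly_eval p ` cube n)"

definition handelman_exponents :: "nat \<Rightarrow> nat \<Rightarrow> ((nat \<Rightarrow> nat) \<times> (nat \<Rightarrow> nat)) set"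
  where "handelman_exponents n t =
    {(\<alpha>, \<beta>). \<alpha> \<in> {1..n} \<rightarrow>\<^sub>E UNIV \<and> \<beta> \<in> {1..n} \<rightarrow>\<^sub>E UNIV \<and> (\<Sum>i=1..n. \<alpha> i + \<beta> i) \<le> t}"

definition handelman_set :: "nat \<Rightarrow> nat \<Rightarrow> rpoly set"
  where "handelman_set n t =
    {\<Sum>(\<alpha>, \<beta>)\<in>handelman_exponents n t.
       Const (c \<alpha> \<beta>) * (\<Prod>i=1..n. Var i ^ \<alpha> i * (1 - Var i) ^ \<beta> i)
     | c :: (nat \<Rightarrow> nat) \<Rightarrow> (nat \<Rightarrow> nat) \<Rightarrow> real.
       \<forall>(\<alpha>, \<beta>)\<in>handelman_exponents n t. 0 \<le> c \<alpha> \<beta>}"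

text \<open>The infimum is taken in the extended reals, so that it is \<open>\<infinity>\<close> if no \<open>r\<close> is feasible.\<close>

definition handelman_bound :: "nat \<Rightarrow> nat \<Rightarrow> rpoly \<Rightarrow> ereal"
  where "handelman_bound n t p = (INF r\<in>{r. Const r - p \<in> handelman_set n t}. ereal r)"

text \<open>
  The quantity \<open>\<lambda>\<^sub>J\<close>. It is meant for \<open>1 \<le> t \<le> n\<close>, \<open>J \<subseteq> {1..n}\<close> and \<open>card J \<le> t\<close>, where none
  of the natural-number subtractions truncates.
\<close>

definition handelman_weight :: "nat \<Rightarrow> nat \<Rightarrow> nat set \<Rightarrow> real"
  where "handelman_weight n t J =
    (real ((n - 1) choose (t - 1)) - real ((n - card J) choose (t - card J)))
      / real ((n - 1) choose (t - 1))"

text \<open>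
  The following two facts show that the index set of the sum in \<^const>\<open>handelman_set\<close> is finite
  and that the maximum in \<^const>\<open>cube_max\<close> exists.
\<close>

lemma finite_handelman_exponents: "finite (handelman_exponents n t)"
proof (rule finite_subset)
  let ?B = "{1..n} \<rightarrow>\<^sub>E {..t}"
  show "finite (?B \<times> ?B)"
    by (intro finite_cartesian_product finite_PiE) auto
  have le: "\<alpha> i + \<beta> i \<le> (\<Sum>i=1..n. \<alpha> i + \<beta> i)" if "i \<in> {1..n}" for \<alpha> \<beta> :: "nat \<Rightarrow> nat" and i
    using that by (intro member_le_sum) auto
  show "handelman_exponents n t \<subseteq> ?B \<times> ?B"
  proof (clarsimp simp: handelman_exponents_def PiE_iff simp del: One_nat_def)
    fix \<alpha> \<beta> :: "nat \<Rightarrow> nat" and i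
    assume *: "(\<Sum>i=1..n. \<alpha> i + \<beta> i) \<le> t"
    have "\<alpha> i \<le> t \<and> \<beta> i \<le> t" if "1 \<le> i" "i \<le> n" for i
      using le[of i \<alpha> \<beta>] that * by simp
    then show "(\<forall>i\<in>{1..n}. \<alpha> i \<le> t) \<and> (\<forall>i\<in>{1..n}. \<beta> i \<le> t)"
      by simp
  qed
qed

lemma compact_cube: "compact (cube n)"
proof -
  have eq: "cube n = (\<Pi>\<^sub>E i\<in>UNIV. if i \<in> {1..n} then {0..1} else {undefined})"
    by (auto simp: cube_def PiE_iff fun_eq_iff extensional_def split: if_splits)
  have "compactin (product_topology (\<lambda>i. euclidean) UNIV) (cube n)"
    unfolding eq by (subst compactin_PiE) auto
  then show ?thesis
    by (simp add: euclidean_product_topology)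
qed

lemma cube_max_attained:
  shows "cube_max n p \<in> poly_eval p ` cube n"
    and "x \<in> cube n \<Longrightarrow> poly_eval p x \<le> cube_max n p"
proof -
  have "continuous_on (cube n) (poly_eval p)"
    unfolding poly_eval_def
    by (intro continuous_intros continuous_on_subset[OF continuous_on_product_coordinates]) auto
  moreover have "(\<lambda>i\<in>{1..n}. 0) \<in> cube n"
    by (auto simp: cube_def)
  ultimately obtain y where y: "y \<in> cube n" "\<And>x. x \<in> cube n \<Longrightarrow> poly_eval p x \<le> poly_eval p y"
    using continuous_attains_sup[OF compact_cube] by blast
  have "cube_max n p = poly_eval p y"
    unfolding cube_max_def using y by (intro Greatest_equality) auto
  with y show "cube_max n p \<in> poly_eval p ` cube n"
    and "x \<in> cube n \<Longrightarrow> poly_eval p x \<le> cube_max n p"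
    by auto
qed

end

theory Submission
  imports Defs
begin

text \<open>
  For \<open>T \<subseteq> {1..n}\<close> with \<open>card T = t\<close>, interpolation at the vertices of the subcube on \<open>T\<close> writes
  the part of \<open>p\<close> supported on \<open>T\<close> as \<open>\<Sum>S\<subseteq>T. p(1\<^sub>S) x\<^sup>S (1-x)\<^sup>T\<^sup>-\<^sup>S\<close>. The products
  \<open>x\<^sup>S (1-x)\<^sup>T\<^sup>-\<^sup>S\<close> sum to 1, so \<open>p\<^sub>m\<^sub>a\<^sub>x\<close> minus that part is a Handelman combination of order \<open>t\<close>.
  Averaging over all \<open>T\<close> with total weight \<open>n/t\<close> gives
  \<open>n/t p\<^sub>m\<^sub>a\<^sub>x - \<Sum>J. p\<^sub>J (1 - \<lambda>\<^sub>J) x\<^sup>J\<close>; the terms \<open>p\<^sub>J \<lambda>\<^sub>J x\<^sup>J\<close> that remain are handled by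
  \<open>x\<^sup>J\<close> itself if \<open>p\<^sub>J < 0\<close> and by \<open>1 - x\<^sup>J\<close>, of degree \<open>card J\<close>, if \<open>p\<^sub>J > 0\<close>.
\<close>

section \<open>Constants and square-free monomials\<close>

lemma Const_0 [simp]: "Const 0 = 0"
  by (simp add: Const_def)

lemma Const_1 [simp]: "Const 1 = 1"
  by (simp add: Const_def)

lemma Const_add: "Const (a + b) = Const a + Const b"
  by (simp add: Const_def single_add)

lemma Const_minus: "Const (- a) = - Const a"
  by (simp add: Const_def single_uminus)

lemma Const_diff: "Const (a - b) = Const a - Const b"
  by (simp add: Const_def single_diff)

lemma Const_mult: "Const (a * b) = Const a * Const b"
  by (simp add: Const_def mult_single)

lemma Const_sum: "Const (sum f A) = (\<Sum>x\<in>A. Const (f x))"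
  by (induction A rule: infinite_finite_induct) (auto simp: Const_add)

lemma Const_of_nat: "Const (of_nat k) = of_nat k"
  by (induction k) (auto simp: Const_add)

text \<open>The exponent vector of the monomial x^J, that is, the indicator function of J. An
  infinite J would give the default sum 0, hence the finiteness assumptions below.\<close>

definition square_free_exponent :: "nat set \<Rightarrow> nat \<Rightarrow>\<^sub>0 nat"
  where "square_free_exponent J = (\<Sum>i\<in>J. Poly_Mapping.single i 1)"

lemma lookup_square_free_exponent:
  assumes "finite J"
  shows "Poly_Mapping.lookup (square_free_exponent J) i = (if i \<in> J then 1 else 0)"
  using assms
  by (induction J) (auto simp: square_free_exponent_def lookup_add lookup_single when_def)

lemma keys_square_free_exponent:
  assumes "finite J"
  shows "Poly_Mapping.keys (square_free_exponent J) = J"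
  using assms by (auto simp: in_keys_iff lookup_square_free_exponent split: if_splits)

lemma square_free_exponent_eq_iff:
  assumes "finite J" "finite K"
  shows "square_free_exponent J = square_free_exponent K \<longleftrightarrow> J = K"
  using assms keys_square_free_exponent by metis

lemma Const_prod_Var:
  assumes "finite J"
  shows "Const c * (\<Prod>i\<in>J. Var i) = Poly_Mapping.single (square_free_exponent J) c"
proof -
  have "(\<Prod>i\<in>J. Var i) = Poly_Mapping.single (square_free_exponent J) 1"
    using assms
    by (induction J) (auto simp: square_free_exponent_def Var_def mult_single)
  then show ?thesis
    by (simp add: Const_def mult_single)
qed

text \<open>Exponents outside the support contribute zero terms. Two polynomials can thus be
  evaluated over a common index set, although cancellation may shrink the support of their
  sum.\<close>

lemma poly_eval_superset:
  assumes "finite A" "Poly_Mapping.keys p \<subseteq> A"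
  shows "poly_eval p x =
    (\<Sum>m\<in>A. Poly_Mapping.lookup p m * (\<Prod>i\<in>Poly_Mapping.keys m. x i ^ Poly_Mapping.lookup m i))"
  unfolding poly_eval_def
  using assms by (intro sum.mono_neutral_left) (auto simp: in_keys_iff)

lemma poly_eval_0 [simp]: "poly_eval 0 x = 0"
  by (simp add: poly_eval_def)

lemma poly_eval_add: "poly_eval (p + q) x = poly_eval p x + poly_eval q x"
proof -
  let ?A = "Poly_Mapping.keys p \<union> Poly_Mapping.keys q"
  have "Poly_Mapping.keys (p + q) \<subseteq> ?A"
    by (rule Poly_Mapping.keys_add)
  then show ?thesis
    by (simp add: poly_eval_superset[of ?A] lookup_add distrib_right sum.distrib)
qed

lemma poly_eval_sum: "poly_eval (sum f A) x = (\<Sum>j\<in>A. poly_eval (f j) x)"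
  by (induction A rule: infinite_finite_induct) (auto simp: poly_eval_add)

lemma poly_eval_square_free:
  assumes "finite V"
  shows "poly_eval (\<Sum>J\<in>Pow V. Const (a J) * (\<Prod>i\<in>J. Var i)) x = (\<Sum>J\<in>Pow V. a J * (\<Prod>i\<in>J. x i))"
proof -
  have "poly_eval (Const c * (\<Prod>i\<in>J. Var i)) x = c * (\<Prod>i\<in>J. x i)" if "J \<subseteq> V" for J c
  proof -
    have "finite J"
      using that assms finite_subset by blast
    then show ?thesis
      \<comment> \<open>The support is empty if \<open>c = 0\<close>; the singleton contains it in
        either case.\<close>
      by (subst poly_eval_superset[of "{square_free_exponent J}"])
        (auto simp: Const_prod_Var keys_square_free_exponent lookup_square_free_exponent)
  qed
  then show ?thesis
    by (auto simp: poly_eval_sum intro!: sum.cong)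
qed

text \<open>Different sets J have different exponent vectors, so no two terms of the sum meet in the
  same monomial.\<close>

lemma lookup_square_free:
  assumes "finite V" "K \<subseteq> V"
  shows "Poly_Mapping.lookup (\<Sum>J\<in>Pow V. Const (a J) * (\<Prod>i\<in>J. Var i)) (square_free_exponent K) = a K"
proof -
  have fin: "finite J" if "J \<subseteq> V" for J
    using that assms finite_subset by blast
  have "Poly_Mapping.lookup (\<Sum>J\<in>Pow V. Const (a J) * (\<Prod>i\<in>J. Var i)) (square_free_exponent K)
      = (\<Sum>J\<in>Pow V. Poly_Mapping.lookup (Const (a J) * (\<Prod>i\<in>J. Var i)) (square_free_exponent K))"
    by (simp add: lookup_sum)
  also have "\<dots> = (\<Sum>J\<in>Pow V. if J = K then a J else 0)"
    using assms fin
    by (intro sum.cong)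
      (auto simp: Const_prod_Var lookup_single square_free_exponent_eq_iff when_def)
  also have "\<dots> = a K"
    using assms by simp
  finally show ?thesis .
qed

text \<open>Translates the hypothesis on the degree of p into a bound on the sets J that carry a
  nonzero coefficient.\<close>

lemma card_le_total_degree:
  assumes "finite V" "K \<subseteq> V" "a K \<noteq> 0"
  shows "card K \<le> total_degree (\<Sum>J\<in>Pow V. Const (a J) * (\<Prod>i\<in>J. Var i))"
proof -
  let ?p = "\<Sum>J\<in>Pow V. Const (a J) * (\<Prod>i\<in>J. Var i)"
  let ?deg = "\<lambda>m :: nat \<Rightarrow>\<^sub>0 nat. \<Sum>i\<in>Poly_Mapping.keys m. Poly_Mapping.lookup m i"
  have "finite K"
    using assms finite_subset by blast
  then have "card K = ?deg (square_free_exponent K)"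
    by (simp add: keys_square_free_exponent lookup_square_free_exponent)
  moreover have "square_free_exponent K \<in> Poly_Mapping.keys ?p"
    unfolding in_keys_iff lookup_square_free[OF assms(1,2)] by (rule assms(3))
  ultimately have "card K \<in> insert 0 (?deg ` Poly_Mapping.keys ?p)"
    by (intro insertI2 image_eqI)
  then show ?thesis
    unfolding total_degree_def by (intro Max_ge) auto
qed

section \<open>The Handelman cone\<close>

lemma handelman_set_0: "0 \<in> handelman_set n t"
  unfolding handelman_set_def by (rule CollectI, rule exI[of _ "\<lambda>_ _. 0"]) simp

lemma handelman_set_add:
  assumes "p \<in> handelman_set n t" "q \<in> handelman_set n t"
  shows "p + q \<in> handelman_set n t"
proof -
  let ?E = "handelman_exponents n t"
  let ?b = "\<lambda>\<alpha> \<beta>. \<Prod>i=1..n. Var i ^ \<alpha> i * (1 - Var i) ^ \<beta> i"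
  obtain c where c: "p = (\<Sum>(\<alpha>, \<beta>)\<in>?E. Const (c \<alpha> \<beta>) * ?b \<alpha> \<beta>)"
    "\<forall>(\<alpha>, \<beta>)\<in>?E. 0 \<le> c \<alpha> \<beta>"
    using assms(1) unfolding handelman_set_def by blast
  obtain d where d: "q = (\<Sum>(\<alpha>, \<beta>)\<in>?E. Const (d \<alpha> \<beta>) * ?b \<alpha> \<beta>)"
    "\<forall>(\<alpha>, \<beta>)\<in>?E. 0 \<le> d \<alpha> \<beta>"
    using assms(2) unfolding handelman_set_def by blast
  have "p + q = (\<Sum>(\<alpha>, \<beta>)\<in>?E. Const (c \<alpha> \<beta> + d \<alpha> \<beta>) * ?b \<alpha> \<beta>)"
    unfolding c d sum.distrib[symmetric]
    by (intro sum.cong) (auto simp: Const_add distrib_right)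
  moreover have "\<forall>(\<alpha>, \<beta>)\<in>?E. 0 \<le> c \<alpha> \<beta> + d \<alpha> \<beta>"
    using c(2) d(2) by fastforce
  ultimately show ?thesis
    unfolding handelman_set_def by (intro CollectI exI[of _ "\<lambda>\<alpha> \<beta>. c \<alpha> \<beta> + d \<alpha> \<beta>"] conjI)
qed

lemma handelman_set_scale:
  assumes "p \<in> handelman_set n t" "0 \<le> r"
  shows "Const r * p \<in> handelman_set n t"
proof -
  let ?E = "handelman_exponents n t"
  let ?b = "\<lambda>\<alpha> \<beta>. \<Prod>i=1..n. Var i ^ \<alpha> i * (1 - Var i) ^ \<beta> i"
  obtain c where c: "p = (\<Sum>(\<alpha>, \<beta>)\<in>?E. Const (c \<alpha> \<beta>) * ?b \<alpha> \<beta>)"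
    "\<forall>(\<alpha>, \<beta>)\<in>?E. 0 \<le> c \<alpha> \<beta>"
    using assms(1) unfolding handelman_set_def by blast
  have "Const r * p = (\<Sum>(\<alpha>, \<beta>)\<in>?E. Const (r * c \<alpha> \<beta>) * ?b \<alpha> \<beta>)"
    unfolding c sum_distrib_left
    by (intro sum.cong) (auto simp: Const_mult mult.assoc)
  moreover have "\<forall>(\<alpha>, \<beta>)\<in>?E. 0 \<le> r * c \<alpha> \<beta>"
    using c(2) assms(2) by fastforce
  ultimately show ?thesis
    unfolding handelman_set_def by (intro CollectI exI[of _ "\<lambda>\<alpha> \<beta>. r * c \<alpha> \<beta>"] conjI)
qed

lemma handelman_set_sum:
  assumes "\<And>j. j \<in> A \<Longrightarrow> f j \<in> handelman_set n t"
  shows "sum f A \<in> handelman_set n t"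
  using assms
  by (induction A rule: infinite_finite_induct) (auto intro: handelman_set_0 handelman_set_add)

text \<open>The exponents are the indicator functions of S and R, and the coefficient family
  \<open>c\<close> is the Kronecker delta at that pair, so the defining sum collapses to one
  product.\<close>

lemma handelman_set_basis:
  assumes S: "S \<subseteq> {1..n}" and R: "R \<subseteq> {1..n}" and card: "card S + card R \<le> t"
  shows "(\<Prod>i\<in>S. Var i) * (\<Prod>i\<in>R. 1 - Var i) \<in> handelman_set n t"
proof -
  let ?E = "handelman_exponents n t"
  let ?b = "\<lambda>\<alpha> \<beta>. \<Prod>i=1..n. Var i ^ \<alpha> i * (1 - Var i) ^ \<beta> i"
  \<comment> \<open>The restriction to \<open>{1..n}\<close> makes the indicator extensional, as
    membership in \<open>handelman_exponents\<close> demands.\<close>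
  define ind :: "nat set \<Rightarrow> nat \<Rightarrow> nat" where "ind A = (\<lambda>i\<in>{1..n}. of_bool (i \<in> A))" for A
  define c :: "(nat \<Rightarrow> nat) \<Rightarrow> (nat \<Rightarrow> nat) \<Rightarrow> real"
    where "c \<alpha> \<beta> = of_bool (\<alpha> = ind S \<and> \<beta> = ind R)" for \<alpha> \<beta>
  have sum_ind: "(\<Sum>i=1..n. ind A i) = card A" if "A \<subseteq> {1..n}" for A
  proof -
    have "(\<Sum>i=1..n. ind A i) = (\<Sum>i=1..n. if i \<in> A then 1 else 0)"
      by (intro sum.cong) (auto simp: ind_def)
    also have "\<dots> = card A"
      using that by (simp add: sum.If_cases Int_absorb1)
    finally show ?thesis .
  qed
  have prod_ind: "(\<Prod>i=1..n. f i ^ ind A i) = (\<Prod>i\<in>A. f i)"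
    if "A \<subseteq> {1..n}" for A and f :: "nat \<Rightarrow> rpoly"
  proof -
    have "(\<Prod>i=1..n. f i ^ ind A i) = (\<Prod>i=1..n. if i \<in> A then f i else 1)"
      by (intro prod.cong) (auto simp: ind_def)
    also have "\<dots> = (\<Prod>i\<in>A. f i)"
      using that by (simp add: prod.If_cases Int_absorb1)
    finally show ?thesis .
  qed
  have mem: "(ind S, ind R) \<in> ?E"
  proof -
    have "(\<Sum>i=1..n. ind S i + ind R i) \<le> t"
      using card unfolding sum.distrib sum_ind[OF S] sum_ind[OF R] .
    then show ?thesis
      by (simp add: handelman_exponents_def) (simp add: ind_def)
  qed
  have "(\<Sum>(\<alpha>, \<beta>)\<in>?E. Const (c \<alpha> \<beta>) * ?b \<alpha> \<beta>)
      = (\<Sum>e\<in>?E. if e = (ind S, ind R) then ?b (ind S) (ind R) else 0)"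
  proof (rule sum.cong)
    fix e :: "(nat \<Rightarrow> nat) \<times> (nat \<Rightarrow> nat)"
    show "(case e of (\<alpha>, \<beta>) \<Rightarrow> Const (c \<alpha> \<beta>) * ?b \<alpha> \<beta>)
        = (if e = (ind S, ind R) then ?b (ind S) (ind R) else 0)"
    proof (cases "e = (ind S, ind R)")
      case False
      then have "c (fst e) (snd e) = 0"
        by (auto simp: c_def prod_eq_iff)
      with False show ?thesis
        by (simp add: split_beta)
    qed (simp add: c_def)
  qed simp
  also have "\<dots> = ?b (ind S) (ind R)"
    using mem by (simp add: finite_handelman_exponents)
  also have "\<dots> = (\<Prod>i\<in>S. Var i) * (\<Prod>i\<in>R. 1 - Var i)"
    by (simp only: prod.distrib prod_ind[OF S] prod_ind[OF R])
  finally have "(\<Prod>i\<in>S. Var i) * (\<Prod>i\<in>R. 1 - Var i) = (\<Sum>(\<alpha>, \<beta>)\<in>?E. Const (c \<alpha> \<beta>) * ?b \<alpha> \<beta>)"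
    by simp
  moreover have "\<forall>(\<alpha>, \<beta>)\<in>?E. 0 \<le> c \<alpha> \<beta>"
    by (simp add: c_def split_beta)
  ultimately show ?thesis
    unfolding handelman_set_def by (intro CollectI exI[of _ c] conjI)
qed

lemma prod_Var_in_handelman_set:
  assumes "J \<subseteq> {1..n}" "card J \<le> t"
  shows "(\<Prod>i\<in>J. Var i) \<in> handelman_set n t"
  using handelman_set_basis[of J n "{}" t] assms by simp

section \<open>Interpolation at the vertices of a subcube\<close>

text \<open>Expand the product over T of the factors x_i + (1 - x_i), each of which equals
  1.\<close>

lemma sum_Pow_bernstein:
  fixes x :: "'i \<Rightarrow> 'a :: comm_ring_1"
  assumes "finite T"
  shows "(\<Sum>S\<in>Pow T. (\<Prod>i\<in>S. x i) * (\<Prod>i\<in>T - S. 1 - x i)) = 1"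
  using prod_add[OF assms, of x "\<lambda>i. 1 - x i"] by simp

text \<open>Writing a superset of J as J together with a subset of T - J pulls out the factor x^J;
  what remains is the partition of unity on T - J.\<close>

lemma sum_supersets_bernstein:
  fixes x :: "'i \<Rightarrow> 'a :: comm_ring_1"
  assumes "finite T" "J \<subseteq> T"
  shows "(\<Sum>S | J \<subseteq> S \<and> S \<subseteq> T. (\<Prod>i\<in>S. x i) * (\<Prod>i\<in>T - S. 1 - x i)) = (\<Prod>i\<in>J. x i)"
proof -
  have fin: "finite J" "finite (T - J)"
    using assms finite_subset by auto
  have "(\<Sum>S | J \<subseteq> S \<and> S \<subseteq> T. (\<Prod>i\<in>S. x i) * (\<Prod>i\<in>T - S. 1 - x i))
      = (\<Sum>S\<in>Pow (T - J). (\<Prod>i\<in>J \<union> S. x i) * (\<Prod>i\<in>T - (J \<union> S). 1 - x i))"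
    by (rule sum.reindex_bij_witness[of _ "\<lambda>S. J \<union> S" "\<lambda>S. S - J"])
      (use assms in \<open>auto simp: Un_absorb1\<close>)
  also have "\<dots> = (\<Sum>S\<in>Pow (T - J).
      (\<Prod>i\<in>J. x i) * ((\<Prod>i\<in>S. x i) * (\<Prod>i\<in>(T - J) - S. 1 - x i)))"
  proof (rule sum.cong)
    fix S assume "S \<in> Pow (T - J)"
    then have "(\<Prod>i\<in>J \<union> S. x i) = (\<Prod>i\<in>J. x i) * (\<Prod>i\<in>S. x i)"
      using fin by (intro prod.union_disjoint) (auto intro: finite_subset)
    moreover have "T - (J \<union> S) = (T - J) - S"
      by auto
    ultimately show "(\<Prod>i\<in>J \<union> S. x i) * (\<Prod>i\<in>T - (J \<union> S). 1 - x i)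
        = (\<Prod>i\<in>J. x i) * ((\<Prod>i\<in>S. x i) * (\<Prod>i\<in>(T - J) - S. 1 - x i))"
      by (simp add: mult.assoc)
  qed simp
  also have "\<dots> = (\<Prod>i\<in>J. x i)"
    using sum_Pow_bernstein[OF fin(2), of x] by (simp flip: sum_distrib_left)
  finally show ?thesis .
qed

text \<open>The sum of \<open>a J\<close> over J contained in S is the value at the vertex 1_S.
  After the sums over S and J are exchanged, the products with S containing J add up to x^J.\<close>

lemma interpolation_subcube:
  assumes "finite T"
  shows "(\<Sum>S\<in>Pow T. Const (\<Sum>J\<in>Pow S. a J) * ((\<Prod>i\<in>S. Var i) * (\<Prod>i\<in>T - S. 1 - Var i)))
      = (\<Sum>J\<in>Pow T. Const (a J) * (\<Prod>i\<in>J. Var i))"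
proof -
  let ?b = "\<lambda>S. (\<Prod>i\<in>S. Var i) * (\<Prod>i\<in>T - S. 1 - Var i)"
  have "(\<Sum>S\<in>Pow T. Const (\<Sum>J\<in>Pow S. a J) * ?b S)
      = (\<Sum>S\<in>Pow T. \<Sum>J | J \<in> Pow T \<and> J \<subseteq> S. Const (a J) * ?b S)"
    by (auto simp: Const_sum sum_distrib_right intro!: sum.cong)
  also have "\<dots> = (\<Sum>J\<in>Pow T. \<Sum>S | S \<in> Pow T \<and> J \<subseteq> S. Const (a J) * ?b S)"
    using assms by (intro sum.swap_restrict) auto
  also have "\<dots> = (\<Sum>J\<in>Pow T. Const (a J) * (\<Sum>S | J \<subseteq> S \<and> S \<subseteq> T. ?b S))"
    by (simp add: sum_distrib_left conj_commute)
  also have "\<dots> = (\<Sum>J\<in>Pow T. Const (a J) * (\<Prod>i\<in>J. Var i))"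
    using assms by (intro sum.cong) (auto simp: sum_supersets_bernstein)
  finally show ?thesis .
qed

text \<open>Multiplying the partition of unity by M and subtracting the interpolation formula leaves
  the coefficients M - p(1_S), nonnegative by \<open>le\<close>, on products of degree
  \<open>card T\<close>.\<close>

lemma Const_minus_subcube_in_handelman_set:
  assumes T: "T \<subseteq> {1..n}" "card T \<le> t"
    and le: "\<And>S. S \<subseteq> T \<Longrightarrow> (\<Sum>J\<in>Pow S. a J) \<le> M"
  shows "Const M - (\<Sum>J\<in>Pow T. Const (a J) * (\<Prod>i\<in>J. Var i)) \<in> handelman_set n t"
proof -
  have fin: "finite T"
    using T finite_subset by blast
  let ?b = "\<lambda>S. (\<Prod>i\<in>S. Var i) * (\<Prod>i\<in>T - S. 1 - Var i)"
  have "Const M = (\<Sum>S\<in>Pow T. Const M * ?b S)"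
    using sum_Pow_bernstein[OF fin, of Var] by (simp flip: sum_distrib_left)
  then have "Const M - (\<Sum>J\<in>Pow T. Const (a J) * (\<Prod>i\<in>J. Var i))
      = (\<Sum>S\<in>Pow T. Const (M - (\<Sum>J\<in>Pow S. a J)) * ?b S)"
    unfolding interpolation_subcube[OF fin, symmetric]
    by (simp add: Const_diff left_diff_distrib sum_subtractf)
  moreover have "Const (M - (\<Sum>J\<in>Pow S. a J)) * ?b S \<in> handelman_set n t" if "S \<subseteq> T" for S
  proof (intro handelman_set_scale handelman_set_basis)
    have "card S + card (T - S) = card T"
      using that fin by (metis card_Diff_subset card_mono finite_subset le_add_diff_inverse)
    then show "card S + card (T - S) \<le> t"
      using T by simp
  qed (use that T le in auto)
  ultimately show ?thesis
    by (simp only:) (rule handelman_set_sum, blast)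
qed

text \<open>The monomial x^J is the term S = J of the partition of unity on J; the other terms all
  have degree \<open>card J\<close>.\<close>

lemma one_minus_prod_Var_in_handelman_set:
  assumes "J \<subseteq> {1..n}" "card J \<le> t"
  shows "1 - (\<Prod>i\<in>J. Var i) \<in> handelman_set n t"
proof -
  have fin: "finite J"
    using assms finite_subset by blast
  let ?b = "\<lambda>S. (\<Prod>i\<in>S. Var i) * (\<Prod>i\<in>J - S. 1 - Var i)"
  have "(\<Sum>S\<in>Pow J. ?b S) = ?b J + (\<Sum>S\<in>Pow J - {J}. ?b S)"
    using fin by (intro sum.remove) auto
  then have "1 - (\<Prod>i\<in>J. Var i) = (\<Sum>S\<in>Pow J - {J}. ?b S)"
    unfolding sum_Pow_bernstein[OF fin] by (simp add: diff_eq_eq add.commute)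
  also have "\<dots> \<in> handelman_set n t"
  proof (intro handelman_set_sum handelman_set_basis)
    fix S assume "S \<in> Pow J - {J}"
    then have S: "S \<subseteq> J"
      by simp
    then have "card S + card (J - S) = card J"
      using fin by (metis card_Diff_subset card_mono finite_subset le_add_diff_inverse)
    with assms S show "card S + card (J - S) \<le> t" "S \<subseteq> {1..n}" "J - S \<subseteq> {1..n}"
      by auto
  qed
  finally show ?thesis .
qed

section \<open>Averaging over subcubes\<close>

text \<open>Removing J is a bijection onto the subsets of V - J of size
  \<open>t - card J\<close>.\<close>

lemma card_supersets:
  assumes "finite V" "J \<subseteq> V" "card J \<le> t"
  shows "card {T. T \<subseteq> V \<and> card T = t \<and> J \<subseteq> T} = (card V - card J) choose (t - card J)"
proof -
  have fin: "finite J" "finite (V - J)"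
    using assms finite_subset by auto
  have fT: "finite T" if "T \<subseteq> V" for T
    using that assms finite_subset by blast
  have "bij_betw (\<lambda>T. T - J) {T. T \<subseteq> V \<and> card T = t \<and> J \<subseteq> T}
      {U. U \<subseteq> V - J \<and> card U = t - card J}"
  proof (rule bij_betwI[where g = "\<lambda>U. U \<union> J"])
    show "(\<lambda>U. U \<union> J) \<in> {U. U \<subseteq> V - J \<and> card U = t - card J}
        \<rightarrow> {T. T \<subseteq> V \<and> card T = t \<and> J \<subseteq> T}"
    proof clarsimp
      fix U assume U: "U \<subseteq> V - J" "card U = t - card J"
      then have "card (U \<union> J) = card U + card J"
        using fin by (intro card_Un_disjoint) (auto intro: finite_subset)
      with U assms show "U \<subseteq> V \<and> J \<subseteq> V \<and> card (U \<union> J) = t"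
        by auto
    qed
  qed (use fin in \<open>auto simp: card_Diff_subset\<close>)
  then have "card {T. T \<subseteq> V \<and> card T = t \<and> J \<subseteq> T} = card {U. U \<subseteq> V - J \<and> card U = t - card J}"
    by (rule bij_betw_same_card)
  also have "\<dots> = (card V - card J) choose (t - card J)"
    using fin assms by (simp add: n_subsets card_Diff_subset)
  finally show ?thesis .
qed

text \<open>Add up the certificates of all subcubes of dimension t. The binomial weight of x^J
  counts the subcubes T that contain J.\<close>

lemma Const_minus_weighted_sum_in_handelman_set:
  assumes le: "\<And>S. S \<subseteq> {1..n} \<Longrightarrow> (\<Sum>J\<in>Pow S. a J) \<le> M"
    and deg: "\<And>J. J \<subseteq> {1..n} \<Longrightarrow> a J \<noteq> 0 \<Longrightarrow> card J \<le> t"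
  shows "Const (real (n choose t) * M)
      - (\<Sum>J\<in>Pow {1..n}. Const (real ((n - card J) choose (t - card J)) * a J) * (\<Prod>i\<in>J. Var i))
    \<in> handelman_set n t"
proof -
  let ?\<T> = "{T. T \<subseteq> {1..n} \<and> card T = t}"
  have fin: "finite ?\<T>"
    by (rule finite_subset[of _ "Pow {1..n}"]) auto
  have card_\<T>: "card ?\<T> = n choose t"
    using n_subsets[of "{1..n}" t] by simp
  have sum_const: "(\<Sum>T\<in>A. Const r) = Const (real (card A) * r)" for A :: "nat set set" and r
    by (simp add: Const_mult Const_of_nat)
  have "(\<Sum>T\<in>?\<T>. \<Sum>J\<in>Pow T. Const (a J) * (\<Prod>i\<in>J. Var i))
      = (\<Sum>T\<in>?\<T>. \<Sum>J | J \<in> Pow {1..n} \<and> J \<subseteq> T. Const (a J) * (\<Prod>i\<in>J. Var i))"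
    by (auto intro!: sum.cong)
  also have "\<dots> = (\<Sum>J\<in>Pow {1..n}. \<Sum>T | T \<in> ?\<T> \<and> J \<subseteq> T. Const (a J) * (\<Prod>i\<in>J. Var i))"
    using fin by (intro sum.swap_restrict) auto
  also have "\<dots> = (\<Sum>J\<in>Pow {1..n}.
      Const (real ((n - card J) choose (t - card J)) * a J) * (\<Prod>i\<in>J. Var i))"
  proof (rule sum.cong)
    fix J assume J: "J \<in> Pow {1..n}"
    have "real (card {T. T \<in> ?\<T> \<and> J \<subseteq> T}) * a J = real ((n - card J) choose (t - card J)) * a J"
    \<comment> \<open>For \<open>card J > t\<close> no T contains J, but the truncated
      \<open>t - card J\<close> makes the binomial equal to 1. By \<open>deg\<close> such a J has
      \<open>a J = 0\<close>.\<close>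
    proof (cases "a J = 0")
      case False
      then have "card {T. T \<subseteq> {1..n} \<and> card T = t \<and> J \<subseteq> T} = (n - card J) choose (t - card J)"
        using J deg[of J] card_supersets[of "{1..n}" J t] by simp
      then show ?thesis
        by (simp add: conj_assoc)
    qed simp
    then show "(\<Sum>T | T \<in> ?\<T> \<and> J \<subseteq> T. Const (a J) * (\<Prod>i\<in>J. Var i))
        = Const (real ((n - card J) choose (t - card J)) * a J) * (\<Prod>i\<in>J. Var i)"
      by (simp only: sum_const flip: sum_distrib_right)
  qed simp
  finally have "Const (real (n choose t) * M)
      - (\<Sum>J\<in>Pow {1..n}. Const (real ((n - card J) choose (t - card J)) * a J) * (\<Prod>i\<in>J. Var i))
    = (\<Sum>T\<in>?\<T>. Const M - (\<Sum>J\<in>Pow T. Const (a J) * (\<Prod>i\<in>J. Var i)))"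
    by (simp only: sum_subtractf sum_const card_\<T>)
  also have "\<dots> \<in> handelman_set n t"
    by (intro handelman_set_sum Const_minus_subcube_in_handelman_set le) auto
  finally show ?thesis .
qed

section \<open>Vertex values of the polynomial and sign of the weights\<close>

text \<open>At the vertex 1_S of the cube, x^J is 1 if J is contained in S and 0 otherwise, so the
  left side is a value of the polynomial on the cube.\<close>

lemma sum_coeffs_le_cube_max:
  assumes S: "S \<subseteq> {1..n}"
  shows "(\<Sum>J\<in>Pow S. a J) \<le> cube_max n (\<Sum>J\<in>Pow {1..n}. Const (a J) * (\<Prod>i\<in>J. Var i))"
proof -
  let ?x = "\<lambda>i\<in>{1..n}. of_bool (i \<in> S) :: real"
  let ?p = "\<Sum>J\<in>Pow {1..n}. Const (a J) * (\<Prod>i\<in>J. Var i)"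
  have vertex: "(\<Prod>i\<in>J. ?x i) = of_bool (J \<subseteq> S)" if "J \<subseteq> {1..n}" for J
  proof -
    have "finite J"
      using that finite_subset by blast
    have "(\<Prod>i\<in>J. ?x i) = (\<Prod>i\<in>J. of_bool (i \<in> S))"
      using that by (intro prod.cong) auto
    also have "\<dots> = of_bool (J \<subseteq> S)"
      using \<open>finite J\<close> by (induction J) auto
    finally show ?thesis .
  qed
  have "(\<Sum>J\<in>Pow S. a J) = (\<Sum>J\<in>Pow {1..n}. a J * of_bool (J \<subseteq> S))"
    using S by (intro sum.mono_neutral_cong_left) auto
  also have "\<dots> = poly_eval ?p ?x"
    unfolding poly_eval_square_free[OF finite_atLeastAtMost]
    by (intro sum.cong refl) (simp only: Pow_iff vertex)
  also have "\<dots> \<le> cube_max n ?p"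
    by (rule cube_max_attained) (auto simp: cube_def)
  finally show ?thesis .
qed

text \<open>By symmetry both binomials have lower index \<open>n - t\<close>, and the upper index
  only grows.\<close>

lemma choose_diff_le:
  assumes "j \<le> t" "t \<le> n"
  shows "(n - j) choose (t - j) \<le> n choose t"
proof -
  have "(n - j) choose (t - j) = (n - j) choose (n - t)"
    using assms by (subst binomial_symmetric) auto
  also have "\<dots> \<le> n choose (n - t)"
    by (rule binomial_right_mono) simp
  also have "\<dots> = n choose t"
    using assms by (metis binomial_symmetric)
  finally show ?thesis .
qed

lemma handelman_weight_nonneg:
  assumes "1 \<le> card J" "card J \<le> t" "t \<le> n"
  shows "0 \<le> handelman_weight n t J"
  \<comment> \<open>Lowering all three parameters by one compares with
    \<open>(n - 1) choose (t - 1)\<close>; since \<open>card J\<close> is at least 1, the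
    differences \<open>n - card J\<close> and \<open>t - card J\<close> are unchanged.\<close>
  using choose_diff_le[of "card J - 1" "t - 1" "n - 1"] assms
  by (simp add: handelman_weight_def)

section \<open>Combination of the averaged certificate with the corrections\<close>

theorem theorem4:
  fixes n t :: nat and a :: "nat set \<Rightarrow> real" and p :: rpoly
  assumes squarefree: "p = (\<Sum>J\<in>Pow {1..n}. Const (a J) * (\<Prod>i\<in>J. Var i))"
    and zero: "poly_eval p (\<lambda>i. 0) = 0"
    and t_pos: "1 \<le> t"
    and deg: "total_degree p \<le> t"
    and t_le: "t \<le> n"
  shows "handelman_bound n t p \<le>
           ereal (real n / real t * cube_max n p
             + (\<Sum>J | J \<subseteq> {1..n} \<and> 2 \<le> card J \<and> 0 < a J. a J * handelman_weight n t J))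
       \<and> ((\<forall>J. J \<subseteq> {1..n} \<and> 2 \<le> card J \<longrightarrow> a J \<le> 0) \<longrightarrow>
           handelman_bound n t p \<le> ereal (real n / real t * cube_max n p))"
proof -
  let ?M = "cube_max n p"
  let ?x = "\<lambda>J. \<Prod>i\<in>J. Var i"
  let ?w = "handelman_weight n t"
  let ?N = "real ((n - 1) choose (t - 1))"
  let ?B = "\<Sum>J | J \<subseteq> {1..n} \<and> 2 \<le> card J \<and> 0 < a J. a J * ?w J"
  \<comment> \<open>The constant that pays for the correction at J: a positive term \<lambda>_J p_J
    x^J is at most \<lambda>_J p_J on the cube, a negative one costs nothing.\<close>
  define b where "b J = (if 2 \<le> card J \<and> 0 < a J then a J * ?w J else 0)" for J
  have "poly_eval p (\<lambda>i. 0) = (\<Sum>J\<in>Pow {1..n}. if J = {} then a J else 0)"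
    unfolding squarefree poly_eval_square_free[OF finite_atLeastAtMost]
  proof (intro sum.cong refl)
    fix J :: "nat set" assume "J \<in> Pow {1..n}"
    then have "finite J"
      using finite_subset by auto
    then show "a J * (\<Prod>i\<in>J. 0) = (if J = {} then a J else 0)"
      by (simp add: card_gt_0_iff)
  qed
  then have a_empty: "a {} = 0"
    using zero by simp
  have card_le: "card J \<le> t" if "J \<subseteq> {1..n}" "a J \<noteq> 0" for J
    using card_le_total_degree[of "{1..n}" J a] that deg squarefree by simp
  have N_pos: "0 < ?N"
    using t_le t_pos by (simp add: zero_less_binomial_iff)
  have choose_weight: "real ((n - card J) choose (t - card J)) = ?N * (1 - ?w J)" for J
    using N_pos by (simp add: handelman_weight_def field_simps)
  \<comment> \<open>This absorption identity is the source of the factor n/t, the quotient of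
    \<open>n choose t\<close> by \<open>?N\<close>.\<close>
  have "t * (n choose t) = n * ((n - 1) choose (t - 1))"
    using t_pos by (intro times_binomial_minus1_eq) simp
  then have "real t * real (n choose t) = real n * ?N"
    by (metis of_nat_mult)
  then have choose_n: "real (n choose t) = ?N * (real n / real t)"
    using t_pos by (simp add: field_simps)

  \<comment> \<open>Dividing by \<open>?N\<close> gives the subcubes total weight n/t and x^J the
    coefficient (1 - \<lambda>_J) p_J.\<close>
  have "Const (1 / ?N) * (Const (real (n choose t) * ?M)
      - (\<Sum>J\<in>Pow {1..n}. Const (real ((n - card J) choose (t - card J)) * a J) * ?x J))
      \<in> handelman_set n t"
    using N_pos card_le sum_coeffs_le_cube_max[of _ n a]
    by (intro handelman_set_scale Const_minus_weighted_sum_in_handelman_set)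
      (auto simp: squarefree)
  also have "Const (1 / ?N) * (Const (real (n choose t) * ?M)
      - (\<Sum>J\<in>Pow {1..n}. Const (real ((n - card J) choose (t - card J)) * a J) * ?x J))
      = Const (real n / real t * ?M) - (\<Sum>J\<in>Pow {1..n}. Const ((1 - ?w J) * a J) * ?x J)"
    unfolding choose_weight choose_n right_diff_distrib sum_distrib_left
      mult.assoc[symmetric] Const_mult[symmetric]
    using N_pos by simp
  finally have avg: "Const (real n / real t * ?M)
      - (\<Sum>J\<in>Pow {1..n}. Const ((1 - ?w J) * a J) * ?x J) \<in> handelman_set n t" .

  have corr: "Const (b J) - Const (?w J * a J) * ?x J \<in> handelman_set n t" if J: "J \<subseteq> {1..n}" for J
  proof (cases "a J = 0 \<or> card J = 1")
    case True
    \<comment> \<open>A singleton has weight 0, because the two binomials in the numerator of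
      \<lambda>_J coincide.\<close>
    then have "?w J * a J = 0" "b J = 0"
      by (auto simp: b_def handelman_weight_def)
    then show ?thesis
      by (simp only: Const_0) (simp add: handelman_set_0)
  next
    case False
    \<comment> \<open>The constant term vanishes since p(0) = 0; hence only sets with at least two
      elements remain, and their weights are nonnegative.\<close>
    have "J \<noteq> {}" "finite J"
      using False a_empty J finite_subset by auto
    then have card: "2 \<le> card J" "card J \<le> t"
      using False card_le[OF J] by (auto simp: Suc_le_eq card_gt_0_iff numeral_2_eq_2 neq_iff)
    then have w: "0 \<le> ?w J"
      using t_le by (intro handelman_weight_nonneg) auto
    show ?thesis
    proof (cases "0 < a J")
      case True
      then have "Const (b J) - Const (?w J * a J) * ?x J = Const (?w J * a J) * (1 - ?x J)"
        using card by (simp add: b_def algebra_simps)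
      then show ?thesis
        using True w card J
        by (simp add: handelman_set_scale one_minus_prod_Var_in_handelman_set)
    next
      case neg: False
      then have "Const (b J) - Const (?w J * a J) * ?x J = Const (?w J * (- a J)) * ?x J"
        by (simp add: b_def Const_minus)
      also have "\<dots> \<in> handelman_set n t"
        using neg w card J
        by (intro handelman_set_scale prod_Var_in_handelman_set mult_nonneg_nonneg) auto
      finally show ?thesis .
    qed
  qed

  have sum_b: "(\<Sum>J\<in>Pow {1..n}. b J) = ?B"
  proof -
    have "{J. J \<subseteq> {1..n} \<and> 2 \<le> card J \<and> 0 < a J} = {J \<in> Pow {1..n}. 2 \<le> card J \<and> 0 < a J}"
      by auto
    then show ?thesis
      unfolding b_def by (simp only: sum.inter_filter finite_Pow_iff finite_atLeastAtMost)
  qed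
  have p_split: "p = (\<Sum>J\<in>Pow {1..n}. Const ((1 - ?w J) * a J) * ?x J)
      + (\<Sum>J\<in>Pow {1..n}. Const (?w J * a J) * ?x J)"
    unfolding squarefree sum.distrib[symmetric] distrib_right[symmetric] Const_add[symmetric]
    by (simp add: algebra_simps)
  \<comment> \<open>The averaged certificate covers the part (1 - \<lambda>_J) p_J x^J of each term
    and the corrections cover the rest, so the claimed value is feasible for the infimum.\<close>
  have "Const (real n / real t * ?M + ?B) - p
      = (Const (real n / real t * ?M) - (\<Sum>J\<in>Pow {1..n}. Const ((1 - ?w J) * a J) * ?x J))
        + (\<Sum>J\<in>Pow {1..n}. Const (b J) - Const (?w J * a J) * ?x J)"
    unfolding sum_subtractf Const_sum[symmetric] sum_b Const_add
    by (subst p_split) simp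
  also have "\<dots> \<in> handelman_set n t"
    using corr by (intro handelman_set_add handelman_set_sum avg) auto
  finally have bound: "handelman_bound n t p \<le> ereal (real n / real t * ?M + ?B)"
    unfolding handelman_bound_def by (intro INF_lower CollectI)
  have no_correction: "?B = 0" if "\<forall>J. J \<subseteq> {1..n} \<and> 2 \<le> card J \<longrightarrow> a J \<le> 0"
    by (rule sum.neutral) (use that not_less in blast)
  show ?thesis
    using bound by (auto dest!: no_correction simp del: One_nat_def)
qed

end
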